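(* Let $p\ge5$ be a prime, let $k$ be odd with $k<p$, and let $b$ be a real number with $e:=b-\frac1{p-1}>0$. Then \[\mathcal{M}^{(k)}_a(b)=V_k(b)\oplus\partial_a\mathcal{M}^{(k)}_a(b).\] Furthermore, $\partial_a$ is injective on $\mathcal{M}^{(k)}_a(b)$.
   Context: $\mathrm{ord}$ is the $p$-adic valuation on $\mathbb{C}_p$ with $\mathrm{ord}(p)=1$, and $\pi\in\mathbb{C}_p$ with $\pi^{p-1}=-p$. For $\rho\in\mathbb{R}$ let $L(b;\rho):=\{\sum_{i\ge0}B_ia^i:B_i\in\mathbb{C}_p,\ \mathrm{ord}(B_i)\ge\frac{2b}{3}i+\rho\ \forall i\}$ and $L(b):=\bigcup_\rho L(b;\rho)$. Let $\delta_j:=bj/3$. Elements of $\mathcal{M}^{(k)}_a$ are row vectors $\xi=(\xi_1,\ldots,\xi_{k+1})$ (coordinates with respect to the ordered basis $v^k,v^{k-1}w,\ldots,w^k$, where $v=x$, $w=x^2$, so $\xi_m$ is the coefficient of $v^{k-m+1}w^{m-1}$). Define $\mathcal{M}^{(k)}_a(b;\rho):=\{\xi:\ \xi_m\in L(b;\delta_m+\rho)\ \text{for } m=1,\ldots,k+1\}$ and $\mathcal{M}^{(k)}_a(b):=\bigcup_\rho\mathcal{M}^{(k)}_a(b;\rho)$. Let $V_k$ be the $\mathbb{C}_p$-span of the constant vectors together with the vectors $a\,e_{2j+1}$ for $j=0,1,\ldots,(k-1)/2$ (where $e_m$ is the $m$-th standard basis row vector, i.e. $a\,v^{k-2j}w^{2j}$),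 and $V_k(b):=V_k\cap\mathcal{M}^{(k)}_a(b)$. $G_k$ is the $(k+1)\times(k+1)$ matrix with $(G_k)_{i,i+1}=(k-i+1)\pi a$, $(G_k)_{i+1,i}=-\frac{i\pi a^2}{3}$ for $1\le i\le k$, and other entries $0$. The operator $\partial_a$ acts by $\partial_a\xi:=a\frac{d\xi}{da}-\xi G_k$. *)

theory Defs
  imports
    "HOL-Analysis.Analysis"
    "HOL-Computational_Algebra.Computational_Algebra"
    "HOL-Library.Function_Algebras"
    "HOL-Library.Set_Algebras"
begin

text \<open>
  The field of \<open>p\<close>-adic complex numbers is the completion of an algebraic closure of the
  \<open>p\<close>-adic numbers; this determines it, together with its valuation, up to isomorphism.
  As \<open>p\<close> is a variable, it is not constructed as a type.  Instead, the predicate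
  \<open>padic_complex_field p ord\<close> below says that the type \<open>'k\<close> with the valuation \<open>ord\<close> is
  such a completion.
\<close>

locale padic_valued_field =
  fixes p :: nat and ord :: "'k::field_char_0 \<Rightarrow> ereal"
  assumes prime_p: "prime p"
    and ord_eq_infinity_iff: "ord x = \<infinity> \<longleftrightarrow> x = 0"
    and ord_not_MInfty: "ord x \<noteq> -\<infinity>"
    and ord_mult: "ord (x * y) = ord x + ord y"
    and ord_add: "min (ord x) (ord y) \<le> ord (x + y)"
    and ord_p: "ord (of_nat p) = 1"
begin

definition pdist :: "'k \<Rightarrow> 'k \<Rightarrow> real" where
  "pdist x y = (if x = y then 0 else real p powr (- real_of_ereal (ord (x - y))))"

lemma ord_one: "ord 1 = 0"
proof -
  have "ord 1 = ord 1 + ord 1" using ord_mult[of 1 1] by simp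
  moreover have "\<bar>ord 1\<bar> \<noteq> \<infinity>"
    using ord_eq_infinity_iff[of 1] ord_not_MInfty[of 1] by auto
  ultimately show ?thesis by (cases "ord 1") auto
qed

lemma ord_uminus: "ord (- x) = ord x"
proof -
  have "ord (-1) + ord (-1) = 0"
    using ord_mult[of "-1" "-1"] ord_one by simp
  then have "ord (-1) = 0" by (cases "ord (-1)") auto
  then show ?thesis using ord_mult[of "-1" x] by simp
qed

sublocale Metric_space UNIV pdist
proof
  show "0 \<le> pdist x y" for x y by (simp add: pdist_def)
  show "pdist x y = pdist y x" for x y
    using ord_uminus[of "x - y"] by (simp add: pdist_def)
  show "pdist x y = 0 \<longleftrightarrow> x = y" for x y
    using prime_gt_0_nat[OF prime_p] by (simp add: pdist_def)
  show "pdist x z \<le> pdist x y + pdist y z" for x y z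
  proof (cases "x = y \<or> y = z \<or> x = z")
    case True
    then show ?thesis by (auto simp: pdist_def)
  next
    case False
    then have fin: "\<bar>ord (x - y)\<bar> \<noteq> \<infinity>" "\<bar>ord (y - z)\<bar> \<noteq> \<infinity>" "\<bar>ord (x - z)\<bar> \<noteq> \<infinity>"
      using ord_eq_infinity_iff ord_not_MInfty by auto
    have "min (ord (x - y)) (ord (y - z)) \<le> ord (x - z)"
      using ord_add[of "x - y" "y - z"] by simp
    with fin have "min (real_of_ereal (ord (x - y))) (real_of_ereal (ord (y - z)))
        \<le> real_of_ereal (ord (x - z))"
      by (cases "ord (x - y)"; cases "ord (y - z)"; cases "ord (x - z)")
         (auto simp: min_def split: if_splits)
    then have "real p powr (- real_of_ereal (ord (x - z)))
        \<le> real p powr (- real_of_ereal (ord (x - y)))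
      \<or> real p powr (- real_of_ereal (ord (x - z)))
        \<le> real p powr (- real_of_ereal (ord (y - z)))"
      using prime_gt_1_nat[OF prime_p] by (auto simp: min_def split: if_splits)
    moreover have "0 \<le> real p powr (- real_of_ereal (ord (x - y)))"
      "0 \<le> real p powr (- real_of_ereal (ord (y - z)))" by simp_all
    ultimately have "real p powr (- real_of_ereal (ord (x - z)))
        \<le> real p powr (- real_of_ereal (ord (x - y)))
          + real p powr (- real_of_ereal (ord (y - z)))"
      by linarith
    then show ?thesis using False by (simp add: pdist_def)
  qed
qed

text \<open>When \<open>'k\<close> is complete, the closure of the rationals is the field of \<open>p\<close>-adic numbers.\<close>

definition Qp :: "'k set" where
  "Qp = mtopology closure_of \<rat>"

definition Qp_bar :: "'k set" where
  "Qp_bar = {x. \<exists>f. f \<noteq> 0 \<and> (\<forall>i. coeff f i \<in> Qp) \<and> poly f x = 0}"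

end

locale padic_complex_field = padic_valued_field +
  assumes complete: mcomplete
    and Qp_bar_alg_closed:
      "(\<forall>i. coeff f i \<in> Qp_bar) \<Longrightarrow> degree f > 0 \<Longrightarrow> \<exists>x\<in>Qp_bar. poly f x = 0"
    and Qp_bar_dense: "mtopology closure_of Qp_bar = UNIV"

text \<open>
  The indeterminate \<open>a\<close> is \<^const>\<open>fps_X\<close>.  A row vector of length \<open>k + 1\<close> is a function on
  the indices \<open>1, \<dots>, k + 1\<close>, extended by \<open>0\<close> to all of \<^typ>\<open>nat\<close>; addition of vectors is
  pointwise.
\<close>

definition L_rho :: "('k::field_char_0 \<Rightarrow> ereal) \<Rightarrow> real \<Rightarrow> real \<Rightarrow> 'k fps set" where
  "L_rho ord b \<rho> = {f. \<forall>i. ord (fps_nth f i) \<ge> ereal (2 * b / 3 * real i + \<rho>)}"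

definition \<delta> :: "real \<Rightarrow> nat \<Rightarrow> real" where
  "\<delta> b j = b * real j / 3"

definition M_rho ::
  "('k::field_char_0 \<Rightarrow> ereal) \<Rightarrow> nat \<Rightarrow> real \<Rightarrow> real \<Rightarrow> (nat \<Rightarrow> 'k fps) set" where
  "M_rho ord k b \<rho> = {\<xi>. (\<forall>m\<in>{1..k+1}. \<xi> m \<in> L_rho ord b (\<delta> b m + \<rho>)) \<and>
                          (\<forall>m. m \<notin> {1..k+1} \<longrightarrow> \<xi> m = 0)}"

definition M :: "('k::field_char_0 \<Rightarrow> ereal) \<Rightarrow> nat \<Rightarrow> real \<Rightarrow> (nat \<Rightarrow> 'k fps) set" where
  "M ord k b = (\<Union>\<rho>. M_rho ord k b \<rho>)"

definition scale :: "'k::field_char_0 \<Rightarrow> (nat \<Rightarrow> 'k fps) \<Rightarrow> (nat \<Rightarrow> 'k fps)" where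
  "scale c \<xi> = (\<lambda>m. fps_const c * \<xi> m)"

lemma vector_space_scale: "vector_space scale"
  by unfold_locales
    (auto simp: scale_def fun_eq_iff algebra_simps simp flip: fps_const_add fps_const_mult)

definition const_vecs :: "nat \<Rightarrow> (nat \<Rightarrow> 'k::field_char_0 fps) set" where
  "const_vecs k = {\<xi>. (\<forall>m\<in>{1..k+1}. \<exists>c. \<xi> m = fps_const c) \<and>
                       (\<forall>m. m \<notin> {1..k+1} \<longrightarrow> \<xi> m = 0)}"

definition unit_vec :: "nat \<Rightarrow> nat \<Rightarrow> 'k::field_char_0 fps" where
  "unit_vec m = (\<lambda>i. if i = m then 1 else 0)"

definition V :: "nat \<Rightarrow> (nat \<Rightarrow> 'k::field_char_0 fps) set" where
  "V k = module.span scale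
     (const_vecs k \<union> {(\<lambda>i. fps_X * unit_vec (2 * j + 1) i) | j. j \<le> (k - 1) div 2})"

definition V_b :: "('k::field_char_0 \<Rightarrow> ereal) \<Rightarrow> nat \<Rightarrow> real \<Rightarrow> (nat \<Rightarrow> 'k fps) set" where
  "V_b ord k b = V k \<inter> M ord k b"

definition G :: "'k::field_char_0 \<Rightarrow> nat \<Rightarrow> nat \<Rightarrow> nat \<Rightarrow> 'k fps" where
  "G \<pi> k i j =
     (if 1 \<le> i \<and> i \<le> k \<and> j = i + 1 then fps_const (of_nat (k - i + 1) * \<pi>) * fps_X
      else if 1 \<le> j \<and> j \<le> k \<and> i = j + 1 then fps_const (- (of_nat j * \<pi> / 3)) * fps_X ^ 2
      else 0)"

definition partial_a ::
  "'k::field_char_0 \<Rightarrow> nat \<Rightarrow> (nat \<Rightarrow> 'k fps) \<Rightarrow> (nat \<Rightarrow> 'k fps)" where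
  "partial_a \<pi> k \<xi> = (\<lambda>j. fps_X * fps_deriv (\<xi> j) - (\<Sum>i=1..k+1. \<xi> i * G \<pi> k i j))"

definition internal_direct_sum ::
  "(nat \<Rightarrow> 'k::field_char_0 fps) set \<Rightarrow> (nat \<Rightarrow> 'k fps) set \<Rightarrow> (nat \<Rightarrow> 'k fps) set \<Rightarrow> bool" where
  "internal_direct_sum U W W' \<longleftrightarrow>
     module.subspace scale U \<and> module.subspace scale W \<and> module.subspace scale W' \<and>
     U = W + W' \<and> W \<inter> W' = {0}"

end

theory Submission
  imports Defs
begin

text \<open>
  Multiplication by \<open>G\<close> lowers the weight \<open>\<rho>\<close> by exactly \<open>e = b - 1/(p - 1)\<close>, and \<open>a d/da\<close> does not
  lower it.  Since the odd and even coordinates decouple in \<open>\<zeta> = v + \<eta> G\<close>, this equation can be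
  solved explicitly; the integers divided by are \<open>p\<close>-adic units because \<open>k < p\<close> and \<open>p \<ge> 5\<close>.  Hence every
  \<open>\<zeta>\<close> of weight \<open>\<rho>\<close> has such a decomposition, and in any such decomposition \<open>v\<close> has weight \<open>\<rho>\<close> and \<open>\<eta>\<close>
  weight \<open>\<rho> + e\<close>.  Iterating on the error \<open>a d\<eta>/da\<close>, whose weight has gone up by \<open>e\<close>, and summing by
  completeness gives \<open>\<zeta> \<in> V\<^sub>k(b) + \<partial>\<^sub>a M(b)\<close>.  Conversely, if \<open>\<partial>\<^sub>a \<eta> \<in> V\<^sub>k\<close>, then \<open>a d\<eta>/da = v + \<eta> G\<close>, so the
  weight of \<open>\<eta>\<close> can be raised by \<open>e\<close> indefinitely and \<open>\<eta> = 0\<close>; this yields both directness of the sum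
  and injectivity.
\<close>

section \<open>Row vectors and the coefficients of vectors in \<open>V k\<close>\<close>

lemma nth_X_deriv: "(fps_X * fps_deriv f) $ n = of_nat n * (f $ n)"
  for f :: "'k::field_char_0 fps"
  by (cases n) simp_all

lemma sum_apply: "(\<Sum>i\<in>A. f i) m = (\<Sum>i\<in>A. f i m)"
  for f :: "'i \<Rightarrow> 'm \<Rightarrow> 'a::comm_monoid_add"
  by (induction A rule: infinite_finite_induct) auto

text \<open>The ambient space without growth condition, so that the algebra of \<open>G\<close> can
  be treated apart from the estimates.\<close>

definition row_vecs :: "nat \<Rightarrow> (nat \<Rightarrow> 'k::field_char_0 fps) set" where
  "row_vecs k = {\<xi>. \<forall>m. m \<notin> {1..k+1} \<longrightarrow> \<xi> m = 0}"

lemma row_vecs_0: "\<xi> \<in> row_vecs k \<Longrightarrow> m = 0 \<or> m > k + 1 \<Longrightarrow> \<xi> m = 0"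
  by (auto simp: row_vecs_def)

lemma subspace_row_vecs: "module.subspace scale (row_vecs k)"
proof -
  interpret vector_space scale by (rule vector_space_scale)
  show ?thesis by (auto simp: subspace_def row_vecs_def scale_def)
qed

text \<open>As \<open>k\<close> is odd, the indices \<open>2 * j + 1\<close> with
  \<open>j \<le> (k - 1) div 2\<close> are exactly the odd ones in \<open>{1..k+1}\<close>.
  Prescribed zero coefficients turn membership in \<open>V k\<close> into linear equations, and they
  can be verified to arbitrary precision, which a span does not offer directly.\<close>

lemma V_eq:
  assumes "odd k"
  shows "V k = {\<xi> \<in> row_vecs k. \<forall>j n. n \<ge> 2 \<or> n = 1 \<and> even j \<longrightarrow> \<xi> j $ n = 0}" (is "_ = ?R")
proof -
  interpret vector_space scale by (rule vector_space_scale)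
  let ?B = "const_vecs k \<union> {(\<lambda>i. fps_X * unit_vec (2 * j + 1) i) | j. j \<le> (k - 1) div 2}"
  have sub: "subspace ?R"
    by (auto simp: subspace_def row_vecs_def scale_def)
  have c: "const_vecs k \<subseteq> ?R"
  proof
    fix \<xi> :: "nat \<Rightarrow> 'a fps" assume x: "\<xi> \<in> const_vecs k"
    have "\<xi> j $ n = 0" if "n \<noteq> 0" for j n
    proof (cases "j \<in> {1..k+1}")
      case True
      then obtain c where "\<xi> j = fps_const c" using x unfolding const_vecs_def by blast
      then show ?thesis using that by simp
    next
      case False
      then show ?thesis using x by (simp add: const_vecs_def)
    qed
    then show "\<xi> \<in> ?R" using x by (auto simp: const_vecs_def row_vecs_def)
  qed
  have "(\<lambda>i. fps_X * unit_vec (2 * j + 1) i) \<in> ?R" if "j \<le> (k - 1) div 2" for j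
    using that assms by (auto simp: row_vecs_def unit_vec_def fps_X_def elim!: oddE)
  with c have "?B \<subseteq> ?R" by blast
  then have 1: "V k \<subseteq> ?R" unfolding V_def using sub by (rule span_minimal)
  have "\<xi> \<in> V k" if x: "\<xi> \<in> ?R" for \<xi>
  proof -
    let ?u = "\<lambda>j i. fps_X * unit_vec (2 * j + 1) i :: 'a fps"
    define c where "c = (\<lambda>m. fps_const (\<xi> m $ 0))"
    define l where "l = (\<lambda>m. \<Sum>j\<le>(k-1) div 2. scale (\<xi> (2*j+1) $ 1) (?u j) m)"
    have "l m $ n = (if n = 1 \<and> odd m then \<xi> m $ 1 else 0)" for m n
    proof -
      have "l m $ n = (\<Sum>j\<le>(k-1) div 2. if j = (m-1) div 2 \<and> odd m \<and> n = 1 then \<xi> m $ 1 else 0)"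
        unfolding l_def fps_sum_nth
        by (intro sum.cong) (auto simp: scale_def unit_vec_def elim!: oddE)
      also have "\<dots> = (if n = 1 \<and> odd m \<and> (m-1) div 2 \<le> (k-1) div 2 then \<xi> m $ 1 else 0)"
        by (cases "n = 1 \<and> odd m") (auto simp: sum.delta)
      \<comment> \<open>An odd \<open>m \<le> k + 1\<close> is at most \<open>k\<close>, because
        \<open>k + 1\<close> is even, so the index bound is automatic. Beyond \<open>k + 1\<close>
        both sides are 0.\<close>
      also have "\<dots> = (if n = 1 \<and> odd m then \<xi> m $ 1 else 0)"
      proof (cases "m \<le> k + 1")
        case True
        then show ?thesis using assms by (auto elim!: oddE)
      next
        case False
        then have "\<xi> m = 0" using x row_vecs_0[of \<xi> k m] by auto
        then show ?thesis by simp
      qed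
      finally show ?thesis .
    qed
    then have "\<xi> m $ n = (c + l) m $ n" for m n
      using x by (cases "n = 0"; cases "n = 1"; cases "even m") (auto simp: c_def)
    then have eq: "\<xi> = c + l" by (intro ext fps_ext)
    have "c \<in> const_vecs k" using x by (auto simp: c_def const_vecs_def row_vecs_def)
    then have "c \<in> V k" unfolding V_def by (intro span_base) auto
    moreover have "l \<in> V k"
    proof -
      have "l = (\<Sum>j\<le>(k-1) div 2. scale (\<xi> (2*j+1) $ 1) (?u j))"
        by (simp add: l_def sum_apply fun_eq_iff)
      moreover have "?u j \<in> span ?B" if "j \<le> (k-1) div 2" for j
        using that by (intro span_base) blast
      ultimately show ?thesis unfolding V_def
        by (simp only:) (intro span_sum span_scale, simp)
    qed
    ultimately show ?thesis unfolding eq V_def by (rule span_add)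
  qed
  with 1 show ?thesis by blast
qed

lemma subspace_V: "module.subspace scale (V k)"
proof -
  interpret vector_space scale by (rule vector_space_scale)
  show ?thesis unfolding V_def by (rule subspace_span)
qed

section \<open>Multiplication by \<open>G\<close> and the operator \<open>partial_a\<close>\<close>

definition mulG :: "'k::field_char_0 \<Rightarrow> nat \<Rightarrow> (nat \<Rightarrow> 'k fps) \<Rightarrow> (nat \<Rightarrow> 'k fps)" where
  "mulG \<pi> k \<xi> = (\<lambda>j. \<Sum>i=1..k+1. \<xi> i * G \<pi> k i j)"

lemma partial_a_eq: "partial_a \<pi> k \<xi> = (\<lambda>j. fps_X * fps_deriv (\<xi> j)) - mulG \<pi> k \<xi>"
  by (simp add: partial_a_def mulG_def fun_eq_iff)

lemma mulG_in_row_vecs: "mulG \<pi> k \<xi> \<in> row_vecs k"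
  by (auto simp: mulG_def row_vecs_def G_def intro!: sum.neutral)

lemma X_deriv_in_row_vecs: "\<xi> \<in> row_vecs k \<Longrightarrow> (\<lambda>j. fps_X * fps_deriv (\<xi> j)) \<in> row_vecs k"
  by (auto simp: row_vecs_def)

text \<open>Column \<open>j\<close> of \<open>G\<close> meets only the neighbours
  \<open>j - 1\<close> and \<open>j + 1\<close>. One formula serves the two ends as well, because
  the missing neighbours \<open>\<xi> 0\<close> and \<open>\<xi> (k + 2)\<close> are 0.\<close>

lemma mulG_eq:
  assumes "\<xi> \<in> row_vecs k" "1 \<le> j" "j \<le> k + 1"
  shows "mulG \<pi> k \<xi> j = fps_X * (fps_const (of_nat (k + 2 - j) * \<pi>) * \<xi> (j - 1)
           - fps_const (of_nat j * \<pi> / 3) * (fps_X * \<xi> (j + 1)))"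
proof -
  have "\<xi> i * G \<pi> k i j =
      (if i = j - 1 then fps_X * (fps_const (of_nat (k + 2 - j) * \<pi>) * \<xi> (j - 1)) else 0)
    + (if i = j + 1 then - (fps_X * (fps_const (of_nat j * \<pi> / 3) * (fps_X * \<xi> (j + 1)))) else 0)"
    if "i \<in> {1..k+1}" for i
  proof -
    have "k - i + 1 = k + 2 - j" if "j = i + 1" using that assms(3) by auto
    then show ?thesis using that assms
      by (auto simp: G_def power2_eq_square mult_ac simp flip: fps_const_neg)
  qed
  then have "mulG \<pi> k \<xi> j =
      (if j - 1 \<in> {1..k+1} then fps_X * (fps_const (of_nat (k + 2 - j) * \<pi>) * \<xi> (j - 1)) else 0)
    + (if j + 1 \<in> {1..k+1} then - (fps_X * (fps_const (of_nat j * \<pi> / 3) * (fps_X * \<xi> (j + 1)))) else 0)"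
    unfolding mulG_def using assms(2,3) by (auto simp: sum.distrib)
  also have "\<dots> = fps_X * (fps_const (of_nat (k + 2 - j) * \<pi>) * \<xi> (j - 1)
           - fps_const (of_nat j * \<pi> / 3) * (fps_X * \<xi> (j + 1)))"
    using assms row_vecs_0[OF assms(1)] by (auto simp: right_diff_distrib)
  finally show ?thesis .
qed

lemma mulG_nth:
  assumes "\<xi> \<in> row_vecs k" "1 \<le> j" "j \<le> k + 1"
  shows "mulG \<pi> k \<xi> j $ 0 = 0"
    and "mulG \<pi> k \<xi> j $ Suc 0 = of_nat (k + 2 - j) * \<pi> * (\<xi> (j - 1) $ 0)"
    and "mulG \<pi> k \<xi> j $ Suc (Suc n) = of_nat (k + 2 - j) * \<pi> * (\<xi> (j - 1) $ Suc n)
           - of_nat j * \<pi> / 3 * (\<xi> (j + 1) $ n)"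
  unfolding mulG_eq[OF assms] by simp_all

lemma mulG_add: "mulG \<pi> k (\<xi> + \<eta>) = mulG \<pi> k \<xi> + mulG \<pi> k \<eta>"
  by (simp add: mulG_def fun_eq_iff distrib_right sum.distrib)

lemma partial_a_add: "partial_a \<pi> k (\<xi> + \<eta>) = partial_a \<pi> k \<xi> + partial_a \<pi> k \<eta>"
  by (simp add: partial_a_eq mulG_add fun_eq_iff algebra_simps)

lemma partial_a_scale: "partial_a \<pi> k (scale c \<xi>) = scale c (partial_a \<pi> k \<xi>)"
  by (simp add: partial_a_def scale_def fun_eq_iff algebra_simps sum_distrib_left)

lemma partial_a_diff: "partial_a \<pi> k (\<xi> - \<eta>) = partial_a \<pi> k \<xi> - partial_a \<pi> k \<eta>"
  using partial_a_add[of \<pi> k "\<xi> - \<eta>" \<eta>] by simp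

lemma subspace_image_partial_a:
  assumes "module.subspace scale S"
  shows "module.subspace scale (partial_a \<pi> k ` S)"
proof -
  interpret vector_space scale by (rule vector_space_scale)
  have "0 \<in> partial_a \<pi> k ` S"
    using subspace_0[OF assms] partial_a_diff[of \<pi> k 0 0] by (metis diff_self image_eqI)
  then show ?thesis
    using assms unfolding subspace_def
    by (auto simp flip: partial_a_add partial_a_scale)
qed

text \<open>The odd-numbered equations of \<open>\<zeta> = v + \<eta> G\<close> involve only the even-numbered coordinates of
  \<open>\<eta>\<close> and are solved upwards from \<open>\<eta>\<^sub>0 = 0\<close>; the even-numbered ones involve only the odd-numbered
  coordinates and are solved downwards from \<open>\<eta>\<^bsub>k+2\<^esub> = 0\<close>.\<close>

lemma ex_mulG_decomposition:
  fixes \<zeta> :: "nat \<Rightarrow> 'k::field_char_0 fps"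
  assumes "odd k" "\<pi> \<noteq> 0" and \<zeta>: "\<zeta> \<in> row_vecs k"
  shows "\<exists>\<eta> \<in> row_vecs k. \<zeta> - mulG \<pi> k \<eta> \<in> V k"
proof -
  obtain q where k: "k = 2 * q + 1" using assms(1) by (auto elim: oddE)
  \<comment> \<open>\<open>E i\<close> is to be coordinate \<open>2 * i\<close> of
    \<open>\<eta>\<close>. The recursion solves equation \<open>2 * i + 1\<close> in degrees
    \<open>n + 2\<close> for the next even coordinate; degrees 0 and 1 are left to
    \<open>v\<close>.\<close>
  define E where "E = rec_nat 0 (\<lambda>i f. fps_const (3 / (of_nat (2*i+1) * \<pi>)) *
    (fps_const (of_nat (k + 2 - (2*i+1)) * \<pi>) * fps_shift 1 f - fps_shift 2 (\<zeta> (2*i+1))))"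
  \<comment> \<open>\<open>D i\<close> is to be coordinate \<open>k + 2 - 2 * i\<close> of
    \<open>\<eta>\<close>. The recursion solves equation \<open>j = k + 1 - 2 * i\<close> in degrees
    \<open>n + 1\<close> for coordinate \<open>j - 1\<close>, whose factor \<open>k + 2 - j\<close>
    equals \<open>2 * i + 1\<close>; only degree 0 is left to \<open>v\<close>.\<close>
  define D where "D = rec_nat 0 (\<lambda>i f. fps_const (1 / (of_nat (2*i+1) * \<pi>)) *
    (fps_shift 1 (\<zeta> (k + 1 - 2*i)) + fps_const (of_nat (k + 1 - 2*i) * \<pi> / 3) * (fps_X * f)))"
  have E: "E 0 = 0" "of_nat (2*i+1) * \<pi> / 3 * (E (Suc i) $ n) =
      of_nat (k + 2 - (2*i+1)) * \<pi> * (E i $ Suc n) - \<zeta> (2*i+1) $ Suc (Suc n)" for i n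
  proof -
    have "(of_nat (2*i+1) :: 'k) \<noteq> 0" by (simp only: of_nat_eq_0_iff)
    then show "of_nat (2*i+1) * \<pi> / 3 * (E (Suc i) $ n) =
      of_nat (k + 2 - (2*i+1)) * \<pi> * (E i $ Suc n) - \<zeta> (2*i+1) $ Suc (Suc n)"
      using assms(2) by (simp add: E_def del: of_nat_add of_nat_mult of_nat_Suc)
  qed (simp add: E_def)
  have D: "D 0 = 0" "of_nat (2*i+1) * \<pi> * (D (Suc i) $ n) =
      \<zeta> (k + 1 - 2*i) $ Suc n + of_nat (k + 1 - 2*i) * \<pi> / 3 * ((fps_X * D i) $ n)" for i n
  proof -
    have "(of_nat (2*i+1) :: 'k) \<noteq> 0" by (simp only: of_nat_eq_0_iff)
    then show "of_nat (2*i+1) * \<pi> * (D (Suc i) $ n) =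
      \<zeta> (k + 1 - 2*i) $ Suc n + of_nat (k + 1 - 2*i) * \<pi> / 3 * ((fps_X * D i) $ n)"
      using assms(2) by (simp add: D_def del: of_nat_add of_nat_mult of_nat_Suc)
  qed (simp add: D_def)
  define \<eta> where "\<eta> = (\<lambda>j. if j \<notin> {1..k+1} then 0 else if even j then E (j div 2) else D (q + 1 - j div 2))"
  have \<eta>: "\<eta> \<in> row_vecs k" by (auto simp: \<eta>_def row_vecs_def)
  \<comment> \<open>This formula and the next include the boundary indices 0 and
    \<open>k + 2\<close>, where the initial values \<open>E 0 = 0\<close> and \<open>D 0 = 0\<close>
    match the zero extension of \<open>\<eta>\<close>.\<close>
  have \<eta>_even: "\<eta> (2*i) = E i" if "i \<le> q + 1" for i
    using that E(1) by (cases i) (auto simp: \<eta>_def k)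
  have \<eta>_odd: "\<eta> (2*i+1) = D (q + 1 - i)" if "i \<le> q + 1" for i
    using that D(1) by (cases "i = q + 1") (auto simp: \<eta>_def k)
  have "(\<zeta> - mulG \<pi> k \<eta>) j $ n = 0" if n: "n \<ge> 2 \<or> n = 1 \<and> even j" for j n
  proof (cases "j \<in> {1..k+1}")
    case False
    then show ?thesis using \<zeta> mulG_in_row_vecs[of \<pi> k \<eta>] by (auto simp: row_vecs_def)
  next
    case j: True
    show ?thesis
    proof (cases "even j")
      case False
      then obtain i where i: "j = 2 * i + 1" by (auto elim: oddE)
      have "i \<le> q" using j i k by auto
      obtain n' where n': "n = Suc (Suc n')" using n False by (metis add_2_eq_Suc le_Suc_ex)
      have "\<eta> (j - 1) = E i" "\<eta> (j + 1) = E (Suc i)"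
        using \<eta>_even[of i] \<eta>_even[of "Suc i"] \<open>i \<le> q\<close> i by auto
      then have "mulG \<pi> k \<eta> j $ n = of_nat (k + 2 - (2*i+1)) * \<pi> * (E i $ Suc n')
          - of_nat (2*i+1) * \<pi> / 3 * (E (Suc i) $ n')"
        unfolding n' i using mulG_nth(3)[OF \<eta>, of "2*i+1" \<pi> n'] j i by simp
      then show ?thesis unfolding E(2) using i n' by simp
    next
      case True
      then obtain i where i: "j = 2 * i" by (auto elim: evenE)
      have iq: "1 \<le> i" "i \<le> q + 1" using j i k by auto
      obtain n' where n': "n = Suc n'" using n by (cases n) auto
      define s where "s = q + 1 - i"
      have "j - 1 = 2 * (i - 1) + 1" using i iq by auto
      then have "\<eta> (j - 1) = D (Suc s)"
        using \<eta>_odd[of "i - 1"] iq by (simp add: s_def Suc_diff_le)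
      moreover have "\<eta> (j + 1) = D s" using \<eta>_odd[of i] iq i by (simp add: s_def)
      moreover have "k + 1 - 2 * s = j" "k + 2 - j = 2 * s + 1" using i iq k s_def by auto
      ultimately have "mulG \<pi> k \<eta> j $ Suc n' = \<zeta> j $ Suc n'"
        using mulG_eq[OF \<eta>, of j \<pi>] j D(2)[of s n'] by simp
      then show ?thesis using n' by simp
    qed
  qed
  moreover have "\<zeta> - mulG \<pi> k \<eta> \<in> row_vecs k"
    using \<zeta> mulG_in_row_vecs[of \<pi> k \<eta>] by (auto simp: row_vecs_def)
  ultimately have "\<zeta> - mulG \<pi> k \<eta> \<in> V k" unfolding V_eq[OF assms(1)] by blast
  then show ?thesis using \<eta> by blast
qed

section \<open>Valuations, completeness and weights\<close>

context padic_valued_field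
begin

lemma ord_0: "ord 0 = \<infinity>"
  by (simp add: ord_eq_infinity_iff)

lemma ord_add_ge: "c \<le> ord x \<Longrightarrow> c \<le> ord y \<Longrightarrow> c \<le> ord (x + y)"
  using ord_add[of x y] by (meson min.boundedI order_trans)

lemma ord_diff_ge: "c \<le> ord x \<Longrightarrow> c \<le> ord y \<Longrightarrow> c \<le> ord (x - y)"
  using ord_add_ge[of c x "- y"] by (simp add: ord_uminus)

lemma ord_mult_ge: "ereal c \<le> ord x \<Longrightarrow> ereal d \<le> ord y \<Longrightarrow> ereal (c + d) \<le> ord (x * y)"
  unfolding ord_mult plus_ereal.simps(1)[symmetric] by (rule add_mono)

lemma ord_mult_cancel:
  assumes "ord u = ereal c" "ereal (c + d) \<le> ord (u * x)"
  shows "ereal d \<le> ord x"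
  using assms by (cases "ord x") (auto simp: ord_mult)

lemma ord_power: "ord x = ereal r \<Longrightarrow> ord (x ^ n) = ereal (real n * r)"
  by (induction n) (simp_all add: ord_one ord_mult algebra_simps)

lemma ord_of_nat_nonneg: "0 \<le> ord (of_nat n)"
  by (induction n) (auto simp: ord_0 ord_one intro!: ord_add_ge)

text \<open>By Bezout, 1 is a combination of \<open>m\<close> and \<open>p\<close> with integer
  coefficients. If both had positive valuation, so would 1.\<close>

lemma ord_of_nat_eq_0:
  assumes "0 < m" "m < p"
  shows "ord (of_nat m) = 0"
proof -
  have "coprime m p"
    using assms prime_p by (metis coprime_commute nat_dvd_not_less prime_imp_coprime)
  then obtain x y where "m * x = p * y + 1"
    using assms(1) by (metis bezout_nat coprime_imp_gcd_eq_1 not_gr0)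
  then have eq: "(1::'k) = of_nat m * of_nat x - of_nat p * of_nat y"
    by (metis add_diff_cancel_left' of_nat_1 of_nat_add of_nat_mult)
  have "\<not> 0 < ord (of_nat m)"
  proof
    assume "0 < ord (of_nat m)"
    then have "min (ord (of_nat m)) 1 \<le> ord (of_nat m * of_nat x)"
      unfolding ord_mult using ord_of_nat_nonneg[of x] 
      by (meson add_increasing2 min.coboundedI1 order_refl)
    moreover have "min (ord (of_nat m)) 1 \<le> ord (of_nat p * of_nat y)"
      unfolding ord_mult ord_p using ord_of_nat_nonneg[of y]
      by (meson add_increasing2 min.coboundedI2 order_refl)
    ultimately have "min (ord (of_nat m)) 1 \<le> ord 1"
      unfolding eq by (rule ord_diff_ge)
    then show False using \<open>0 < ord (of_nat m)\<close> by (auto simp: ord_one min_def split: if_splits)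
  qed
  then show ?thesis using ord_of_nat_nonneg[of m] by simp
qed

lemma ord_ge_cong: "ereal c \<le> ord x \<Longrightarrow> d = c \<Longrightarrow> ereal d \<le> ord x"
  by simp

lemma eq_0_if_ord_unbounded:
  assumes "e > 0" "\<And>N::nat. ereal (c + real N * e) \<le> ord x"
  shows "x = 0"
proof (rule ccontr)
  assume "x \<noteq> 0"
  then obtain r where r: "ord x = ereal r"
    using ord_eq_infinity_iff ord_not_MInfty by (cases "ord x") auto
  obtain N :: nat where "r - c < real N * e" using reals_Archimedean3[OF assms(1)] by blast
  then show False using assms(2)[of N] r by simp
qed

text \<open>Links the metric, in which completeness is stated, to the valuation, in which all the
  bounds are stated.\<close>

lemma pdist_le_iff: "pdist x y \<le> real p powr (- c) \<longleftrightarrow> ereal c \<le> ord (x - y)"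
proof (cases "x = y")
  case False
  then obtain r where "ord (x - y) = ereal r"
    using ord_eq_infinity_iff[of "x - y"] ord_not_MInfty by (cases "ord (x - y)") auto
  then show ?thesis using False prime_gt_1_nat[OF prime_p] by (simp add: pdist_def)
qed (simp add: pdist_def ord_0)

end

text \<open>By the ultrametric inequality every tail inherits the bound of its first term, so the
  partial sums are Cauchy, and the bound passes to the limit by comparison with a late partial sum.
  The error bound for each \<open>N\<close> is kept because the iteration in
  \<open>ex_decomposition\<close> needs it.\<close>

lemma (in padic_complex_field) ex_sum_if_ord_ge:
  assumes e: "e > 0" and x: "\<And>s::nat. ereal (c + real s * e) \<le> ord (x s)"
  shows "\<exists>L. \<forall>N. ereal (c + real N * e) \<le> ord (L - (\<Sum>s<N. x s))"
proof -
  define S where "S N = (\<Sum>s<N. x s)" for N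
  have tail: "ereal (c + real N * e) \<le> ord (S m - S N)" if "N \<le> m" for N m
    using that
  proof (induction m rule: dec_induct)
    case (step m)
    have "ereal (c + real N * e) \<le> ereal (c + real m * e)" using step e by simp
    also have "\<dots> \<le> ord (x m)" by (rule x)
    finally have "ereal (c + real N * e) \<le> ord ((S m - S N) + x m)"
      using step by (intro ord_add_ge)
    then show ?case by (simp add: S_def algebra_simps)
  qed (simp add: ord_0)
  have p1: "real p > 1" using prime_gt_1_nat[OF prime_p] by simp
  have "MCauchy S"
    unfolding MCauchy_def
  proof (intro conjI allI impI)
    fix \<epsilon> :: real assume "\<epsilon> > 0"
    obtain N :: nat where "- log (real p) \<epsilon> - c < real N * e"
      using reals_Archimedean3[OF e] by blast
    then have "- (c + real N * e) < log (real p) \<epsilon>" by simp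
    then have N: "real p powr (- (c + real N * e)) < \<epsilon>"
      using p1 \<open>\<epsilon> > 0\<close> by (metis less_log_iff)
    have "pdist (S n) (S n') < \<epsilon>" if "N \<le> n" "N \<le> n'" for n n'
    proof -
      have "ereal (c + real N * e) \<le> ord ((S n - S N) - (S n' - S N))"
        using that by (intro ord_diff_ge tail)
      then have "pdist (S n) (S n') \<le> real p powr (- (c + real N * e))"
        using pdist_le_iff[of "S n" "S n'" "c + real N * e"] by simp
      then show ?thesis using N by linarith
    qed
    then show "\<exists>N. \<forall>n n'. N \<le> n \<longrightarrow> N \<le> n' \<longrightarrow> pdist (S n) (S n') < \<epsilon>" by blast
  qed simp
  then obtain L where L: "limitin mtopology S L sequentially"
    using complete unfolding mcomplete_def by blast
  have "ereal (c + real N * e) \<le> ord (L - S N)" for N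
  proof -
    have "real p powr (- (c + real N * e)) > 0" using p1 by simp
    then obtain N' where "\<And>n. N' \<le> n \<Longrightarrow> pdist (S n) L < real p powr (- (c + real N * e))"
      using L unfolding limit_metric_sequentially by blast
    then have "pdist (S (max N N')) L < real p powr (- (c + real N * e))" by simp
    then have "ereal (c + real N * e) \<le> ord (S (max N N') - L)"
      unfolding pdist_le_iff[symmetric] by simp
    moreover have "ereal (c + real N * e) \<le> ord (S (max N N') - S N)" by (rule tail) simp
    ultimately have "ereal (c + real N * e) \<le> ord ((S (max N N') - S N) - (S (max N N') - L))"
      by (rule ord_diff_ge[rotated])
    then show ?thesis by simp
  qed
  then show ?thesis unfolding S_def by blast
qed

text \<open>Entries outside \<open>{1..k+1}\<close> are 0 and have infinite valuation, so the bound
  may range over all \<open>j\<close>. This spares case distinctions at the neighbours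
  \<open>j - 1\<close> and \<open>j + 1\<close>.\<close>

lemma (in padic_valued_field) M_rho_iff:
  "\<xi> \<in> M_rho ord k b \<rho> \<longleftrightarrow> \<xi> \<in> row_vecs k \<and>
     (\<forall>j n. ereal (2 * b / 3 * real n + b * real j / 3 + \<rho>) \<le> ord (\<xi> j $ n))"
proof -
  have "ereal c \<le> ord (\<xi> j $ n)" if "\<xi> \<in> row_vecs k" "j \<notin> {1..k+1}" for c j n
    using that by (simp add: row_vecs_def ord_0)
  then show ?thesis
    unfolding M_rho_def L_rho_def \<delta>_def row_vecs_def mem_Collect_eq add.assoc by blast
qed

section \<open>Weight estimates under the hypotheses on \<open>p\<close>, \<open>k\<close> and
  \<open>b\<close>\<close>

locale symmetric_power_module = padic_complex_field p ord
  for p :: nat and ord :: "'k::field_char_0 \<Rightarrow> ereal" +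
  fixes \<pi> :: 'k and k :: nat and b :: real
  assumes pi_power: "\<pi> ^ (p - 1) = - of_nat p"
    and p_ge_5: "p \<ge> 5"
    and odd_k: "odd k" and k_less_p: "k < p"
    and b_gr: "b - 1 / (real p - 1) > 0"
begin

definition e :: real where
  "e = b - 1 / (real p - 1)"

lemma e_pos: "e > 0"
  using b_gr by (simp add: e_def)

text \<open>Taking valuations in \<open>pi_power\<close> gives \<open>1 / (real p - 1)\<close>.
  Writing it as \<open>b - e\<close> lets it cancel against the weights.\<close>

lemma ord_pi: "ord \<pi> = ereal (b - e)"
proof -
  have "p - 1 \<noteq> 0" using p_ge_5 by simp
  then have "\<pi> \<noteq> 0" using pi_power p_ge_5 by (auto simp: zero_power)
  then obtain r where r: "ord \<pi> = ereal r"
    using ord_eq_infinity_iff ord_not_MInfty by (cases "ord \<pi>") auto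
  have "ereal (real (p - 1) * r) = 1"
    using ord_power[OF r, of "p - 1"] unfolding pi_power ord_uminus ord_p by (rule sym)
  then have "(real p - 1) * r = 1" using p_ge_5 by (simp add: of_nat_diff one_ereal_def)
  then have "r = 1 / (real p - 1)" using p_ge_5 by (simp add: field_simps)
  then show ?thesis using r by (simp add: e_def)
qed

lemma pi_neq_0: "\<pi> \<noteq> 0"
  using ord_pi ord_0 by auto

lemma ord_divide_3: "ord (x / 3) = ord x"
proof -
  have "ord 3 = 0" using ord_of_nat_eq_0[of 3] p_ge_5 by simp
  then show ?thesis using ord_mult[of 3 "x / 3"] by simp
qed

text \<open>Division needs this exact value, whereas the lower bounds below suffice for
  multiplication. The hypothesis \<open>k < p\<close> provides \<open>m < p\<close> for the integers
  divided by.\<close>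

lemma ord_of_nat_mult_pi:
  assumes "0 < m" "m < p"
  shows "ord (of_nat m * \<pi>) = ereal (b - e)"
  using ord_of_nat_eq_0[OF assms] by (simp add: ord_mult ord_pi)

lemma ord_of_nat_mult_pi_ge: "ereal (b - e) \<le> ord (of_nat m * \<pi>)"
  unfolding ord_mult ord_pi using ord_of_nat_nonneg[of m] by (simp add: add_increasing)

lemma ord_of_nat_mult_pi_div_3_ge: "ereal (b - e) \<le> ord (of_nat m * \<pi> / 3)"
  unfolding ord_divide_3 by (rule ord_of_nat_mult_pi_ge)

lemma M_rho_antimono:
  assumes "\<rho>' \<le> \<rho>"
  shows "M_rho ord k b \<rho> \<subseteq> M_rho ord k b \<rho>'"
proof
  fix \<xi> assume \<xi>: "\<xi> \<in> M_rho ord k b \<rho>"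
  have "ereal (2 * b / 3 * real n + b * real j / 3 + \<rho>') \<le> ord (\<xi> j $ n)" for j n
  proof -
    have "ereal (2 * b / 3 * real n + b * real j / 3 + \<rho>')
        \<le> ereal (2 * b / 3 * real n + b * real j / 3 + \<rho>)" using assms by simp
    also have "\<dots> \<le> ord (\<xi> j $ n)" using \<xi> unfolding M_rho_iff by blast
    finally show ?thesis .
  qed
  then show "\<xi> \<in> M_rho ord k b \<rho>'" using \<xi> unfolding M_rho_iff by blast
qed

lemma M_rho_add: "\<xi> \<in> M_rho ord k b \<rho> \<Longrightarrow> \<eta> \<in> M_rho ord k b \<rho> \<Longrightarrow> \<xi> + \<eta> \<in> M_rho ord k b \<rho>"
  by (auto simp: M_rho_iff row_vecs_def intro: ord_add_ge)

lemma M_rho_diff: "\<xi> \<in> M_rho ord k b \<rho> \<Longrightarrow> \<eta> \<in> M_rho ord k b \<rho> \<Longrightarrow> \<xi> - \<eta> \<in> M_rho ord k b \<rho>"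
  by (auto simp: M_rho_iff row_vecs_def intro: ord_diff_ge)

lemma subspace_M: "module.subspace scale (M ord k b)"
proof -
  interpret vector_space scale by (rule vector_space_scale)
  show ?thesis
  proof (rule subspaceI)
    have "0 \<in> M_rho ord k b 0" by (simp add: M_rho_iff row_vecs_def ord_0)
    then show "0 \<in> M ord k b" by (auto simp: M_def)
  next
    fix \<xi> \<eta> assume "\<xi> \<in> M ord k b" "\<eta> \<in> M ord k b"
    then obtain \<rho> \<rho>' where "\<xi> \<in> M_rho ord k b \<rho>" "\<eta> \<in> M_rho ord k b \<rho>'" by (auto simp: M_def)
    then have "\<xi> + \<eta> \<in> M_rho ord k b (min \<rho> \<rho>')"
      using M_rho_antimono[of "min \<rho> \<rho>'" \<rho>] M_rho_antimono[of "min \<rho> \<rho>'" \<rho>']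
      by (intro M_rho_add) auto
    then show "\<xi> + \<eta> \<in> M ord k b" by (auto simp: M_def)
  next
    fix c \<xi> assume "\<xi> \<in> M ord k b"
    then obtain \<rho> where \<rho>: "\<xi> \<in> M_rho ord k b \<rho>" by (auto simp: M_def)
    \<comment> \<open>A lower bound instead of the value, since \<open>ord c\<close> is infinite for
      \<open>c = 0\<close>.\<close>
    obtain r where r: "ereal r \<le> ord c"
      by (cases "ord c") (use ord_not_MInfty in auto)
    have "ereal (2 * b / 3 * real n + b * real j / 3 + (\<rho> + r)) \<le> ord (scale c \<xi> j $ n)" for j n
    proof -
      have "ereal (2 * b / 3 * real n + b * real j / 3 + \<rho>) \<le> ord (\<xi> j $ n)"
        using \<rho> by (auto simp: M_rho_iff)
      from ord_mult_ge[OF r this] show ?thesis by (simp add: scale_def algebra_simps)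
    qed
    then have "scale c \<xi> \<in> M_rho ord k b (\<rho> + r)"
      using \<rho> by (auto simp: M_rho_iff row_vecs_def scale_def)
    then show "scale c \<xi> \<in> M ord k b" by (auto simp: M_def)
  qed
qed

lemma X_deriv_in_M_rho:
  assumes "\<xi> \<in> M_rho ord k b \<rho>"
  shows "(\<lambda>j. fps_X * fps_deriv (\<xi> j)) \<in> M_rho ord k b \<rho>"
proof -
  have "c \<le> ord (of_nat n * x)" if "c \<le> ord x" for c n x
    unfolding ord_mult using add_increasing[OF ord_of_nat_nonneg that] .
  then show ?thesis
    using assms X_deriv_in_row_vecs unfolding M_rho_iff nth_X_deriv by blast
qed

text \<open>A degree weighs \<open>2 * b / 3\<close> and an index step \<open>b / 3\<close>. The
  entry with \<open>fps_X\<close> raises degree and index by 1, the one with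
  \<open>fps_X ^ 2\<close> raises the degree by 2 and lowers the index by 1: either way the required
  valuation grows by \<open>b\<close>, of which \<open>\<pi>\<close> supplies
  \<open>b - e\<close>.\<close>

lemma mulG_in_M_rho:
  assumes "\<xi> \<in> M_rho ord k b \<rho>"
  shows "mulG \<pi> k \<xi> \<in> M_rho ord k b (\<rho> - e)"
proof -
  have \<xi>: "\<xi> \<in> row_vecs k"
    and le: "ereal (2 * b / 3 * real n + b * real j / 3 + \<rho>) \<le> ord (\<xi> j $ n)" for j n
    using assms by (auto simp: M_rho_iff)
  have "ereal (2 * b / 3 * real n + b * real j / 3 + (\<rho> - e)) \<le> ord (mulG \<pi> k \<xi> j $ n)" for j n
  proof (cases "j \<in> {1..k+1}")
    case False
    then show ?thesis using mulG_in_row_vecs[of \<pi> k \<xi>] by (simp add: row_vecs_def ord_0)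
  next
    case True
    then have j: "1 \<le> j" "j \<le> k + 1" by auto
    have 1: "ereal (2 * b / 3 * real (Suc n) + b * real j / 3 + (\<rho> - e))
      \<le> ord (of_nat (k + 2 - j) * \<pi> * (\<xi> (j - 1) $ n))" for n
      by (rule ord_ge_cong[OF ord_mult_ge[OF ord_of_nat_mult_pi_ge le]])
        (use j in \<open>simp add: of_nat_diff field_simps\<close>)
    have 2: "ereal (2 * b / 3 * real (Suc (Suc n)) + b * real j / 3 + (\<rho> - e))
      \<le> ord (of_nat j * \<pi> / 3 * (\<xi> (j + 1) $ n))" for n
      by (rule ord_ge_cong[OF ord_mult_ge[OF ord_of_nat_mult_pi_div_3_ge le]])
        (simp add: field_simps)
    consider "n = 0" | "n = Suc 0" | n' where "n = Suc (Suc n')" by (metis not0_implies_Suc)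
    then show ?thesis
    proof cases
      case 1 then show ?thesis by (simp add: mulG_nth[OF \<xi> j] ord_0)
    next
      case 2 then show ?thesis using "1"[of 0] by (simp add: mulG_nth[OF \<xi> j])
    next
      case 3
      show ?thesis unfolding 3 mulG_nth(3)[OF \<xi> j] by (intro ord_diff_ge "1" "2")
    qed
  qed
  then show ?thesis using mulG_in_row_vecs by (auto simp: M_rho_iff)
qed

lemma partial_a_in_M_rho:
  assumes "\<xi> \<in> M_rho ord k b \<rho>"
  shows "partial_a \<pi> k \<xi> \<in> M_rho ord k b (\<rho> - e)"
  unfolding partial_a_eq using X_deriv_in_M_rho[OF assms] mulG_in_M_rho[OF assms]
    M_rho_antimono[of "\<rho> - e" \<rho>] e_pos by (intro M_rho_diff) auto

lemma partial_a_in_M: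
  assumes "\<xi> \<in> M ord k b"
  shows "partial_a \<pi> k \<xi> \<in> M ord k b"
  using assms partial_a_in_M_rho by (auto simp: M_def)

text \<open>The recursions that solve for \<open>\<eta>\<close> are followed with bounds: each step
  divides by an element of valuation exactly \<open>b - e\<close>, reversing the count in
  \<open>mulG_in_M_rho\<close>. The vector \<open>\<eta>\<close> is arbitrary, so the estimate also
  applies where \<open>\<eta>\<close> is given and not constructed.\<close>

lemma decomposition_estimate:
  assumes \<zeta>: "\<zeta> \<in> M_rho ord k b \<rho>" and \<eta>: "\<eta> \<in> row_vecs k"
    and v: "\<zeta> - mulG \<pi> k \<eta> \<in> V k"
  shows "\<eta> \<in> M_rho ord k b (\<rho> + e)"
proof -
  obtain q where k: "k = 2 * q + 1" using odd_k by (auto elim: oddE)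
  have le: "ereal (2 * b / 3 * real n + b * real j / 3 + \<rho>) \<le> ord (\<zeta> j $ n)" for j n
    using \<zeta> by (auto simp: M_rho_iff)
  have eq: "\<zeta> j $ n = mulG \<pi> k \<eta> j $ n" if "n \<ge> 2 \<or> n = 1 \<and> even j" for j n
    using v that unfolding V_eq[OF odd_k] by auto
  have ev: "ereal (2 * b / 3 * real n + b * real (2 * i) / 3 + (\<rho> + e)) \<le> ord (\<eta> (2 * i) $ n)" for i n
  proof (induction i arbitrary: n)
    case 0
    show ?case using row_vecs_0[OF \<eta>, of 0] by (simp add: ord_0)
  next
    case (Suc i)
    show ?case
    proof (cases "2 * i + 1 \<le> k")
      case False
      then show ?thesis using row_vecs_0[OF \<eta>, of "2 * Suc i"] k by (simp add: ord_0)
    next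
      case True
      let ?j = "2 * i + 1"
      \<comment> \<open>The bound wanted for \<open>\<eta> (2 * Suc i) $ n\<close>, increased by the
        valuation \<open>b - e\<close> of its coefficient.\<close>
      let ?c = "(b - e) + (2 * b / 3 * real n + b * real (2 * Suc i) / 3 + (\<rho> + e))"
      have 1: "ereal ?c \<le> ord (of_nat (k + 2 - ?j) * \<pi> * (\<eta> (2 * i) $ Suc n))"
        by (rule ord_ge_cong[OF ord_mult_ge[OF ord_of_nat_mult_pi_ge Suc.IH]])
          (simp add: field_simps)
      have 2: "ereal ?c \<le> ord (\<zeta> ?j $ Suc (Suc n))"
        by (rule ord_ge_cong[OF le]) (simp add: field_simps)
      have "of_nat ?j * \<pi> / 3 * (\<eta> (2 * Suc i) $ n) =
          of_nat (k + 2 - ?j) * \<pi> * (\<eta> (2 * i) $ Suc n) - \<zeta> ?j $ Suc (Suc n)"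
        using mulG_nth(3)[OF \<eta>, of ?j \<pi> n] eq[of "Suc (Suc n)" ?j] True by simp
      then have "ereal ?c \<le> ord (of_nat ?j * \<pi> / 3 * (\<eta> (2 * Suc i) $ n))"
        using ord_diff_ge[OF 1 2] by (simp only:)
      moreover have "ord (of_nat ?j * \<pi> / 3) = ereal (b - e)"
        unfolding ord_divide_3 using True k_less_p by (intro ord_of_nat_mult_pi) auto
      ultimately show ?thesis by (rule ord_mult_cancel[rotated])
    qed
  qed
  \<comment> \<open>Downward induction: \<open>i\<close> is the distance of \<open>l\<close> from
    \<open>q + 1\<close>, which belongs to the zero coordinate \<open>k + 2\<close>.\<close>
  have od: "ereal (2 * b / 3 * real n + b * real (2 * l + 1) / 3 + (\<rho> + e)) \<le> ord (\<eta> (2 * l + 1) $ n)"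
    if "l + i = q + 1" for i l n
    using that
  proof (induction i arbitrary: l n)
    case 0
    then show ?case using row_vecs_0[OF \<eta>, of "2 * l + 1"] k by (simp add: ord_0)
  next
    case (Suc i)
    let ?j = "2 * l + 2"
    let ?c = "(b - e) + (2 * b / 3 * real n + b * real (2 * l + 1) / 3 + (\<rho> + e))"
    have j: "1 \<le> ?j" "?j \<le> k + 1" using Suc.prems k by auto
    have 1: "ereal ?c \<le> ord (\<zeta> ?j $ Suc n)"
      by (rule ord_ge_cong[OF le]) (simp add: field_simps)
    have 2: "ereal ?c \<le> ord (of_nat ?j * \<pi> / 3 * ((fps_X * \<eta> (?j + 1)) $ n))"
    proof (cases n)
      case 0
      then show ?thesis by (simp add: ord_0)
    next
      case (Suc n')
      have "ereal (2 * b / 3 * real n' + b * real (2 * Suc l + 1) / 3 + (\<rho> + e)) \<le> ord (\<eta> (2 * Suc l + 1) $ n')"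
        using Suc.IH[of "Suc l" n'] Suc.prems by simp
      from ord_mult_ge[OF ord_of_nat_mult_pi_div_3_ge this]
      have "ereal ?c \<le> ord (of_nat ?j * \<pi> / 3 * (\<eta> (2 * Suc l + 1) $ n'))"
        by (rule ord_ge_cong) (simp add: Suc field_simps)
      then show ?thesis using Suc by simp
    qed
    have eqj: "\<zeta> ?j $ Suc n = mulG \<pi> k \<eta> ?j $ Suc n" by (rule eq) auto
    have "of_nat (k + 2 - ?j) * \<pi> * (\<eta> (2 * l + 1) $ n) =
        \<zeta> ?j $ Suc n + of_nat ?j * \<pi> / 3 * ((fps_X * \<eta> (?j + 1)) $ n)"
      using mulG_eq[OF \<eta> j, of \<pi>] eqj by simp
    then have "ereal ?c \<le> ord (of_nat (k + 2 - ?j) * \<pi> * (\<eta> (2 * l + 1) $ n))"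
      using ord_add_ge[OF 1 2] by (simp only:)
    moreover have "ord (of_nat (k + 2 - ?j) * \<pi>) = ereal (b - e)"
      using j k_less_p by (intro ord_of_nat_mult_pi) auto
    ultimately show ?case by (rule ord_mult_cancel[rotated])
  qed
  have "ereal (2 * b / 3 * real n + b * real j / 3 + (\<rho> + e)) \<le> ord (\<eta> j $ n)" for j n
  proof (cases "even j")
    case True
    then show ?thesis using ev by (auto elim!: evenE)
  next
    case False
    then obtain l where l: "j = 2 * l + 1" by (auto elim: oddE)
    show ?thesis
    proof (cases "j \<le> k + 1")
      case True
      then show ?thesis using od[of l "q + 1 - l" n] l k by simp
    next
      case False
      then show ?thesis using row_vecs_0[OF \<eta>, of j] by (simp add: ord_0)
    qed
  qed
  then show ?thesis using \<eta> by (auto simp: M_rho_iff)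
qed

section \<open>Iterating the estimate\<close>

lemma partial_a_in_V_imp_0:
  assumes "\<eta> \<in> M ord k b" "partial_a \<pi> k \<eta> \<in> V k"
  shows "\<eta> = 0"
proof -
  obtain \<rho> where \<rho>: "\<eta> \<in> M_rho ord k b \<rho>" using assms(1) by (auto simp: M_def)
  have N: "\<eta> \<in> M_rho ord k b (\<rho> + real N * e)" for N
  proof (induction N)
    case (Suc N)
    \<comment> \<open>The estimate is applied with
      \<open>\<lambda>j. fps_X * fps_deriv (\<eta> j)\<close> as \<open>\<zeta>\<close>: it has at
      least the weight known for \<open>\<eta>\<close>, and subtracting
      \<open>mulG \<pi> k \<eta>\<close> leaves \<open>partial_a \<pi> k \<eta>\<close>.\<close>
    have "\<eta> \<in> M_rho ord k b (\<rho> + real N * e + e)"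
      using X_deriv_in_M_rho[OF Suc] assms(2) \<rho> unfolding partial_a_eq
      by (intro decomposition_estimate) (auto simp: M_rho_iff)
    then show ?case by (simp add: algebra_simps)
  qed (use \<rho> in simp)
  have "\<eta> j $ n = 0" for j n
    using N e_pos by (intro eq_0_if_ord_unbounded[of e "2 * b / 3 * real n + b * real j / 3 + \<rho>"])
      (auto simp: M_rho_iff add.assoc)
  then show ?thesis by (simp add: fun_eq_iff fps_eq_iff)
qed

lemma ex_decomposition:
  assumes "\<zeta> \<in> M ord k b"
  shows "\<exists>\<eta> \<in> M ord k b. \<zeta> + partial_a \<pi> k \<eta> \<in> V k"
proof -
  interpret vs: vector_space "scale :: 'k \<Rightarrow> _" by (rule vector_space_scale)
  obtain \<rho> where \<rho>: "\<zeta> \<in> M_rho ord k b \<rho>" using assms by (auto simp: M_def)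
  obtain h where h: "h \<xi> \<in> row_vecs k" "\<xi> - mulG \<pi> k (h \<xi>) \<in> V k" if "\<xi> \<in> row_vecs k" for \<xi>
    using ex_mulG_decomposition[OF odd_k pi_neq_0] by metis
  \<comment> \<open>\<open>Z s\<close> is the error left after \<open>s\<close> rounds. Modulo
    \<open>V k\<close>, \<open>Z s\<close> is \<open>mulG \<pi> k (h (Z s))\<close>, so adding
    \<open>partial_a \<pi> k (h (Z s))\<close> leaves \<open>Z (Suc s)\<close>.\<close>
  define Z where "Z = rec_nat \<zeta> (\<lambda>_ \<xi> j. fps_X * fps_deriv (h \<xi> j))"
  have Z0: "Z 0 = \<zeta>" and ZSuc: "Z (Suc s) = (\<lambda>j. fps_X * fps_deriv (h (Z s) j))" for s
    by (simp_all add: Z_def)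
  have est: "h \<xi> \<in> M_rho ord k b (\<sigma> + e)" if "\<xi> \<in> M_rho ord k b \<sigma>" for \<xi> \<sigma>
    using that h[of \<xi>] by (intro decomposition_estimate[OF that]) (auto simp: M_rho_iff)
  have Z: "Z s \<in> M_rho ord k b (\<rho> + real s * e)" for s
  proof (induction s)
    case (Suc s)
    from X_deriv_in_M_rho[OF est[OF Suc]] show ?case by (simp add: ZSuc algebra_simps)
  qed (simp add: Z0 \<rho>)
  have hZ: "h (Z s) \<in> M_rho ord k b (\<rho> + e + real s * e)" for s
    using est[OF Z[of s]] by (simp add: algebra_simps)
  define S where "S N = (\<Sum>s<N. h (Z s))" for N
  have S: "\<zeta> + partial_a \<pi> k (S N) - Z N \<in> V k" for N
  proof (induction N)
    case 0
    have "\<zeta> + partial_a \<pi> k (S 0) - Z 0 = 0"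
      using partial_a_diff[of \<pi> k 0 0] by (simp add: S_def Z0)
    then show ?case using vs.subspace_0[OF subspace_V] by metis
  next
    case (Suc N)
    have "Z N - mulG \<pi> k (h (Z N)) \<in> V k" using Z[of N] h by (auto simp: M_rho_iff)
    with Suc have "(\<zeta> + partial_a \<pi> k (S N) - Z N) + (Z N - mulG \<pi> k (h (Z N))) \<in> V k"
      by (rule vs.subspace_add[OF subspace_V])
    moreover have "partial_a \<pi> k (S (Suc N)) = partial_a \<pi> k (S N) + (Z (Suc N) - mulG \<pi> k (h (Z N)))"
      unfolding ZSuc partial_a_eq[of \<pi> k "h (Z N)", symmetric] by (simp add: S_def partial_a_add)
    then have "\<zeta> + partial_a \<pi> k (S (Suc N)) - Z (Suc N)
        = (\<zeta> + partial_a \<pi> k (S N) - Z N) + (Z N - mulG \<pi> k (h (Z N)))"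
      by (simp add: algebra_simps)
    ultimately show ?case by (simp only:)
  qed
  \<comment> \<open>The corrections are summed coefficient by coefficient, with an error bound
    uniform enough to give a weight for \<open>\<eta> - S N\<close>.\<close>
  have "\<exists>L. \<forall>N. ereal (2 * b / 3 * real n + b * real j / 3 + (\<rho> + e) + real N * e)
      \<le> ord (L - (\<Sum>s<N. h (Z s) j $ n))" for j n
    using hZ e_pos by (intro ex_sum_if_ord_ge) (auto simp: M_rho_iff add.assoc)
  then obtain L where L: "ereal (2 * b / 3 * real n + b * real j / 3 + (\<rho> + e) + real N * e)
      \<le> ord (L j n - (\<Sum>s<N. h (Z s) j $ n))" for j n N
    by metis
  define \<eta> where "\<eta> = (\<lambda>j. if j \<in> {1..k+1} then Abs_fps (L j) else 0)"
  have hZ_row: "h (Z s) \<in> row_vecs k" for s using hZ[of s] by (simp add: M_rho_iff)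
  have D: "\<eta> - S N \<in> M_rho ord k b (\<rho> + e + real N * e)" for N
  proof -
    have "S N j = 0" if "j \<notin> {1..k+1}" for j
      using hZ_row that by (auto simp: S_def sum_apply row_vecs_def intro!: sum.neutral)
    then have row: "\<eta> - S N \<in> row_vecs k" by (auto simp: row_vecs_def \<eta>_def)
    have "ereal (2 * b / 3 * real n + b * real j / 3 + (\<rho> + e + real N * e)) \<le> ord ((\<eta> - S N) j $ n)" for j n
    proof (cases "j \<in> {1..k+1}")
      case True
      then show ?thesis
        using L[of n j N] by (simp add: \<eta>_def S_def sum_apply fps_sum_nth add.assoc)
    next
      case False
      then show ?thesis using row by (simp add: row_vecs_def ord_0)
    qed
    then show ?thesis using row by (auto simp: M_rho_iff)
  qed
  have "\<eta> \<in> M_rho ord k b (\<rho> + e)" using D[of 0] by (simp add: S_def)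
  then have \<eta>: "\<eta> \<in> M ord k b" by (auto simp: M_def)
  let ?\<theta> = "\<zeta> + partial_a \<pi> k \<eta>"
  have "?\<theta> j $ n = 0" if jn: "n \<ge> 2 \<or> n = 1 \<and> even j" for j n
  \<comment> \<open>For each \<open>N\<close>, \<open>?\<theta>\<close> differs from a vector in
    \<open>V k\<close> by \<open>Z N + partial_a \<pi> k (\<eta> - S N)\<close>. Both terms have
    weight \<open>\<rho> + real N * e\<close>: the extra \<open>e\<close> in the weight of
    \<open>\<eta> - S N\<close> pays for \<open>partial_a\<close>.\<close>
  proof (rule eq_0_if_ord_unbounded[OF e_pos])
    fix N :: nat
    have "partial_a \<pi> k (\<eta> - S N) \<in> M_rho ord k b (\<rho> + real N * e)"
      using partial_a_in_M_rho[OF D[of N]] by simp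
    with Z[of N] have "Z N + partial_a \<pi> k (\<eta> - S N) \<in> M_rho ord k b (\<rho> + real N * e)"
      by (rule M_rho_add)
    moreover have "?\<theta> j $ n = (Z N + partial_a \<pi> k (\<eta> - S N)) j $ n"
      using S[of N] jn unfolding V_eq[OF odd_k] partial_a_diff by (auto simp: algebra_simps)
    ultimately show "ereal (2 * b / 3 * real n + b * real j / 3 + \<rho> + real N * e) \<le> ord (?\<theta> j $ n)"
      by (auto simp: M_rho_iff add.assoc)
  qed
  moreover have "?\<theta> \<in> row_vecs k"
    using \<rho> partial_a_in_M[OF \<eta>] by (auto simp: M_def M_rho_iff row_vecs_def)
  ultimately have "?\<theta> \<in> V k" unfolding V_eq[OF odd_k] by blast
  with \<eta> show ?thesis by blast
qed

section \<open>Injectivity and the direct sum\<close>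

lemma inj_on_partial_a: "inj_on (partial_a \<pi> k) (M ord k b)"
proof (rule inj_onI)
  interpret vs: vector_space "scale :: 'k \<Rightarrow> _" by (rule vector_space_scale)
  fix \<xi> \<eta> assume "\<xi> \<in> M ord k b" "\<eta> \<in> M ord k b" "partial_a \<pi> k \<xi> = partial_a \<pi> k \<eta>"
  then have "\<xi> - \<eta> = 0"
    using vs.subspace_diff[OF subspace_M] vs.subspace_0[OF subspace_V]
    by (intro partial_a_in_V_imp_0) (auto simp: partial_a_diff)
  then show "\<xi> = \<eta>" by simp
qed

lemma direct_sum: "internal_direct_sum (M ord k b) (V_b ord k b) (partial_a \<pi> k ` M ord k b)"
proof -
  interpret vs: vector_space "scale :: 'k \<Rightarrow> _" by (rule vector_space_scale)
  have V: "vs.subspace (V_b ord k b)"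
    unfolding V_b_def using subspace_V subspace_M by (rule vs.subspace_inter)
  have I: "vs.subspace (partial_a \<pi> k ` M ord k b)"
    using subspace_M by (rule subspace_image_partial_a)
  have "\<zeta> \<in> V_b ord k b + partial_a \<pi> k ` M ord k b" if \<zeta>: "\<zeta> \<in> M ord k b" for \<zeta>
  proof -
    obtain \<eta> where \<eta>: "\<eta> \<in> M ord k b" "\<zeta> + partial_a \<pi> k \<eta> \<in> V k"
      using ex_decomposition[OF \<zeta>] by blast
    then have "\<zeta> + partial_a \<pi> k \<eta> \<in> V_b ord k b"
      unfolding V_b_def using vs.subspace_add[OF subspace_M \<zeta> partial_a_in_M] by blast
    moreover have "- partial_a \<pi> k \<eta> \<in> partial_a \<pi> k ` M ord k b"
      using \<eta>(1) by (intro vs.subspace_neg[OF I]) auto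
    ultimately have "(\<zeta> + partial_a \<pi> k \<eta>) + - partial_a \<pi> k \<eta>
        \<in> V_b ord k b + partial_a \<pi> k ` M ord k b"
      by (rule set_plus_intro)
    then show ?thesis by simp
  qed
  moreover have "V_b ord k b + partial_a \<pi> k ` M ord k b \<subseteq> M ord k b"
    using vs.subspace_add[OF subspace_M] partial_a_in_M by (auto simp: V_b_def elim!: set_plus_elim)
  \<comment> \<open>If \<open>partial_a \<pi> k \<eta>\<close> lies in \<open>V k\<close>, then
    \<open>\<eta> = 0\<close>, hence the common vector is 0.\<close>
  moreover have "V_b ord k b \<inter> partial_a \<pi> k ` M ord k b \<subseteq> {0}"
    using partial_a_in_V_imp_0 partial_a_diff[of \<pi> k 0 0] by (auto simp: V_b_def)
  moreover have "0 \<in> V_b ord k b \<inter> partial_a \<pi> k ` M ord k b"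
    using vs.subspace_0[OF V] vs.subspace_0[OF I] by blast
  ultimately show ?thesis
    unfolding internal_direct_sum_def using subspace_M V I by blast
qed

end

theorem theorem6p3:
  fixes p k :: nat and b :: real
    and ord :: "'k::field_char_0 \<Rightarrow> ereal" and \<pi> :: 'k
  assumes "padic_complex_field p ord"
    and "\<pi> ^ (p - 1) = - of_nat p"
    and "prime p" and "p \<ge> 5"
    and "odd k" and "k < p"
    and "b - 1 / (real p - 1) > 0"
  shows "internal_direct_sum (M ord k b) (V_b ord k b) (partial_a \<pi> k ` M ord k b)
       \<and> inj_on (partial_a \<pi> k) (M ord k b)"
proof -
  interpret padic_complex_field p ord by fact
  interpret symmetric_power_module p ord \<pi> k b
    by unfold_locales (use assms in auto)
  show ?thesis using direct_sum inj_on_partial_a by blast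
qed

end
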